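(* Let $t$ be a purchase decision tree with leaf revenues $(r_{t,\ell})_{\ell \in \mathrm{leaves}(t)}$ and let $\mathbf{x} \in [0,1]^n$. Let $\mathbf{y}_t$ be a solution produced by the primal greedy algorithm and let $(\boldsymbol{\alpha}_t, \boldsymbol{\beta}_t, \gamma_t)$ be the solution produced by the dual greedy algorithm from the output $(\mathcal{E}, f)$ of that run of the primal greedy algorithm. Then: (a) $\mathbf{y}_t$ is an optimal solution of the primal subproblem (P); and (b) $(\boldsymbol{\alpha}_t, \boldsymbol{\beta}_t, \gamma_t)$ is an optimal solution of the dual subproblem (D).
   Context: Let $\mathcal{N} = \{1,\dots,n\}$ be the set of products and $0$ the no-purchase option, with revenues $\rho_i$ ($i \in \mathcal{N}$) and $\rho_0 = 0$. A purchase decision tree $t$ is a finite rooted binary tree in which every non-leaf node (called a split) has exactly one left child and one right child; $\mathrm{splits}(t)$ and $\mathrm{leaves}(t)$ are its sets of splits and leaves. Each split $s$ is labelled with a product $v(t,s) \in \mathcal{N}$ and each leaf $\ell$ with an option $c(t,\ell) \in \mathcal{N} \cup \{0\}$; $r_{t,\ell} = \rho_{c(t,\ell)}$. Standing assumption: if a split $s'$ is a descendant of a split $s$, then $v(t,s) \neq v(t,s')$. For a split $s$, $\mathrm{left}(s)$ (resp. $\mathrm{right}(s)$) is the set of leaves in the subtree rooted at the left (resp. right) child of $s$. For a leaf $\ell$, $\mathrm{LS}(\ell) = \{s \in \mathrm{splits}(t) : \ell \in \mathrm{left}(s)\}$ and $\mathrm{RS}(\ell) = \{s \in \mathrm{splits}(t)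 : \ell \in \mathrm{right}(s)\}$. The depth $d(s)$ of a split is defined so that the root split has depth 1 and depth increases by 1 from parent to child; $d_{\max}$ is the largest depth of a split. Primal subproblem (P): maximize $\sum_{\ell \in \mathrm{leaves}(t)} r_{t,\ell}\, y_{t,\ell}$ over $\mathbf{y}_t = (y_{t,\ell})_{\ell\in\mathrm{leaves}(t)}$ subject to $\sum_{\ell \in \mathrm{leaves}(t)} y_{t,\ell} = 1$; $\ \sum_{\ell \in \mathrm{left}(s)} y_{t,\ell} \le x_{v(t,s)}$ for all $s \in \mathrm{splits}(t)$; $\ \sum_{\ell \in \mathrm{right}(s)} y_{t,\ell} \le 1 - x_{v(t,s)}$ for all $s \in \mathrm{splits}(t)$; $\ y_{t,\ell} \ge 0$ for all $\ell$. Dual subproblem (D): minimize $\sum_{s \in \mathrm{splits}(t)} x_{v(t,s)} \alpha_{t,s} + \sum_{s \in \mathrm{splits}(t)} (1 - x_{v(t,s)}) \beta_{t,s} + \gamma_t$ subject to $\sum_{s:\, \ell \in \mathrm{left}(s)} \alpha_{t,s} + \sum_{s:\, \ell \in \mathrm{right}(s)} \beta_{t,s} + \gamma_t \ge r_{t,\ell}$ for all $\ell \in \mathrm{leaves}(t)$; $\alpha_{t,s} \ge 0$, $\beta_{t,s} \ge 0$ for all $s \in \mathrm{splits}(t)$ ($\gamma_t$ free). Primal greedy algorithm. Fix a bijection $\tau: \{1,\dots,|\mathrm{leaves}(t)|\} \to \mathrm{leaves}(t)$ with $r_{t,\tau(1)} \ge r_{t,\tau(2)} \ge \cdots$. Initialize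 $y_{t,\ell} = 0$ for all $\ell$ and $\mathcal{E} = \emptyset$ (a set of formal events, which are of the form $A_s$, $B_s$ for $s \in \mathrm{splits}(t)$, or $C$). For $i = 1,2,\dots,|\mathrm{leaves}(t)|$: 1. set $q_C = 1 - \sum_{j<i} y_{t,\tau(j)}$; for $s \in \mathrm{LS}(\tau(i))$ set $q_s = x_{v(t,s)} - \sum_{j<i:\, \tau(j) \in \mathrm{left}(s)} y_{t,\tau(j)}$; for $s \in \mathrm{RS}(\tau(i))$ set $q_s = 1 - x_{v(t,s)} - \sum_{j<i:\, \tau(j) \in \mathrm{right}(s)} y_{t,\tau(j)}$; 2. set $q_{A,B} = \min\{q_s : s \in \mathrm{LS}(\tau(i)) \cup \mathrm{RS}(\tau(i))\}$ (with $\min \emptyset = +\infty$), $q^* = \min\{q_C, q_{A,B}\}$, and $y_{t,\tau(i)} = q^*$; 3. if $q^* = q_C$: add $C$ to $\mathcal{E}$, set $f(C) = \tau(i)$, and terminate; 4. otherwise: let $s^*$ be the split in $\mathrm{LS}(\tau(i)) \cup \mathrm{RS}(\tau(i))$ minimizing $q_s$, ties broken by smallest depth $d(s)$; let $e = A_{s^*}$ if $s^* \in \mathrm{LS}(\tau(i))$ and $e = B_{s^*}$ if $s^* \in \mathrm{RS}(\tau(i))$; if $e \notin \mathcal{E}$, add $e$ to $\mathcal{E}$ and set $f(e) = \tau(i)$. The output is $\mathbf{y}_t$, $\mathcal{E}$ and $f: \mathcal{E} \to \mathrm{leaves}(t)$. Dual greedy algorithm (using $\mathcal{E}$, $f$).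 Initialize all $\alpha_{t,s} = \beta_{t,s} = 0$ and set $\gamma_t = r_{t,f(C)}$. For $d = 1,\dots,d_{\max}$ and each split $s$ with $d(s) = d$: if $A_s \in \mathcal{E}$, set $$\alpha_{t,s} = r_{t,f(A_s)} - \gamma_t - \sum_{\substack{s' \in \mathrm{LS}(f(A_s)):\\ A_{s'} \in \mathcal{E},\, d(s') < d}} \alpha_{t,s'} - \sum_{\substack{s' \in \mathrm{RS}(f(A_s)):\\ B_{s'} \in \mathcal{E},\, d(s') < d}} \beta_{t,s'};$$ if $B_s \in \mathcal{E}$, set $$\beta_{t,s} = r_{t,f(B_s)} - \gamma_t - \sum_{\substack{s' \in \mathrm{LS}(f(B_s)):\\ A_{s'} \in \mathcal{E},\, d(s') < d}} \alpha_{t,s'} - \sum_{\substack{s' \in \mathrm{RS}(f(B_s)):\\ B_{s'} \in \mathcal{E},\, d(s') < d}} \beta_{t,s'}.$$ *)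

theory Defs
  imports Complex_Main "HOL-Library.Sublist"
begin

text \<open>
  Products are the numbers \<open>1, \<dots>, n\<close> and \<open>0\<close> is the no-purchase option. A node of a tree is
  addressed by the path leading to it from the root, so that the root is \<open>[]\<close> and the subtree
  rooted at a node \<open>p\<close> consists of the nodes having \<open>p\<close> as a prefix.
\<close>

datatype side = Left | Right

type_synonym node = "side list"

datatype pdtree = Leaf nat | Split nat pdtree pdtree

fun splits :: "pdtree \<Rightarrow> node set" where
  "splits (Leaf c) = {}"
| "splits (Split v l r) = {[]} \<union> (#) Left ` splits l \<union> (#) Right ` splits r"

fun leaves :: "pdtree \<Rightarrow> node set" where
  "leaves (Leaf c) = {[]}"
| "leaves (Split v l r) = (#) Left ` leaves l \<union> (#) Right ` leaves r"

fun split_label :: "pdtree \<Rightarrow> node \<Rightarrow> nat" where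
  "split_label (Split v l r) [] = v"
| "split_label (Split v l r) (Left # p) = split_label l p"
| "split_label (Split v l r) (Right # p) = split_label r p"
| "split_label (Leaf c) p = undefined"

fun leaf_label :: "pdtree \<Rightarrow> node \<Rightarrow> nat" where
  "leaf_label (Leaf c) [] = c"
| "leaf_label (Leaf c) (_ # p) = undefined"
| "leaf_label (Split v l r) [] = undefined"
| "leaf_label (Split v l r) (Left # p) = leaf_label l p"
| "leaf_label (Split v l r) (Right # p) = leaf_label r p"

lemma finite_splits [simp]: "finite (splits t)"
  by (induction t) auto

lemma finite_leaves [simp]: "finite (leaves t)"
  by (induction t) auto

definition purchase_tree :: "nat \<Rightarrow> pdtree \<Rightarrow> bool" where
  "purchase_tree n t \<longleftrightarrow>
     (\<forall>s\<in>splits t. split_label t s \<in> {1..n}) \<and>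
     (\<forall>l\<in>leaves t. leaf_label t l \<in> {0..n}) \<and>
     (\<forall>s\<in>splits t. \<forall>s'\<in>splits t. strict_prefix s s' \<longrightarrow> split_label t s \<noteq> split_label t s')"

definition revenue :: "(nat \<Rightarrow> real) \<Rightarrow> pdtree \<Rightarrow> node \<Rightarrow> real" where
  "revenue \<rho> t l = \<rho> (leaf_label t l)"

definition left_leaves :: "pdtree \<Rightarrow> node \<Rightarrow> node set" where
  "left_leaves t s = {l \<in> leaves t. prefix (s @ [Left]) l}"

definition right_leaves :: "pdtree \<Rightarrow> node \<Rightarrow> node set" where
  "right_leaves t s = {l \<in> leaves t. prefix (s @ [Right]) l}"

definition LS :: "pdtree \<Rightarrow> node \<Rightarrow> node set" where
  "LS t l = {s \<in> splits t. l \<in> left_leaves t s}"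

definition RS :: "pdtree \<Rightarrow> node \<Rightarrow> node set" where
  "RS t l = {s \<in> splits t. l \<in> right_leaves t s}"

definition depth :: "node \<Rightarrow> nat" where
  "depth s = length s + 1"

text \<open>The value \<open>0\<close> for a tree without splits makes the loop over depths empty.\<close>

definition max_depth :: "pdtree \<Rightarrow> nat" where
  "max_depth t = (if splits t = {} then 0 else Max (depth ` splits t))"


subsection \<open>The primal and dual subproblems\<close>

text \<open>
  Vectors indexed by leaves (splits) are functions on nodes of which only the values at the leaves
  (splits) of the tree are constrained.
\<close>

definition primal_feasible :: "pdtree \<Rightarrow> (nat \<Rightarrow> real) \<Rightarrow> (node \<Rightarrow> real) \<Rightarrow> bool" where
  "primal_feasible t x y \<longleftrightarrow>
     (\<Sum>l\<in>leaves t. y l) = 1 \<and>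
     (\<forall>s\<in>splits t. (\<Sum>l\<in>left_leaves t s. y l) \<le> x (split_label t s)) \<and>
     (\<forall>s\<in>splits t. (\<Sum>l\<in>right_leaves t s. y l) \<le> 1 - x (split_label t s)) \<and>
     (\<forall>l\<in>leaves t. y l \<ge> 0)"

definition primal_objective :: "(nat \<Rightarrow> real) \<Rightarrow> pdtree \<Rightarrow> (node \<Rightarrow> real) \<Rightarrow> real" where
  "primal_objective \<rho> t y = (\<Sum>l\<in>leaves t. revenue \<rho> t l * y l)"

definition primal_optimal ::
    "(nat \<Rightarrow> real) \<Rightarrow> pdtree \<Rightarrow> (nat \<Rightarrow> real) \<Rightarrow> (node \<Rightarrow> real) \<Rightarrow> bool" where
  "primal_optimal \<rho> t x y \<longleftrightarrow>
     primal_feasible t x y \<and>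
     (\<forall>y'. primal_feasible t x y' \<longrightarrow> primal_objective \<rho> t y' \<le> primal_objective \<rho> t y)"

definition dual_feasible ::
    "(nat \<Rightarrow> real) \<Rightarrow> pdtree \<Rightarrow> (node \<Rightarrow> real) \<Rightarrow> (node \<Rightarrow> real) \<Rightarrow> real \<Rightarrow> bool" where
  "dual_feasible \<rho> t \<alpha> \<beta> \<gamma> \<longleftrightarrow>
     (\<forall>l\<in>leaves t. (\<Sum>s\<in>LS t l. \<alpha> s) + (\<Sum>s\<in>RS t l. \<beta> s) + \<gamma> \<ge> revenue \<rho> t l) \<and>
     (\<forall>s\<in>splits t. \<alpha> s \<ge> 0 \<and> \<beta> s \<ge> 0)"

definition dual_objective ::
    "pdtree \<Rightarrow> (nat \<Rightarrow> real) \<Rightarrow> (node \<Rightarrow> real) \<Rightarrow> (node \<Rightarrow> real) \<Rightarrow> real \<Rightarrow> real" where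
  "dual_objective t x \<alpha> \<beta> \<gamma> =
     (\<Sum>s\<in>splits t. x (split_label t s) * \<alpha> s) +
     (\<Sum>s\<in>splits t. (1 - x (split_label t s)) * \<beta> s) + \<gamma>"

definition dual_optimal ::
    "(nat \<Rightarrow> real) \<Rightarrow> pdtree \<Rightarrow> (nat \<Rightarrow> real) \<Rightarrow>
      (node \<Rightarrow> real) \<Rightarrow> (node \<Rightarrow> real) \<Rightarrow> real \<Rightarrow> bool" where
  "dual_optimal \<rho> t x \<alpha> \<beta> \<gamma> \<longleftrightarrow>
     dual_feasible \<rho> t \<alpha> \<beta> \<gamma> \<and>
     (\<forall>\<alpha>' \<beta>' \<gamma>'. dual_feasible \<rho> t \<alpha>' \<beta>' \<gamma>' \<longrightarrow>
        dual_objective t x \<alpha> \<beta> \<gamma> \<le> dual_objective t x \<alpha>' \<beta>' \<gamma>')"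


subsection \<open>The primal greedy algorithm\<close>

definition revenue_order :: "(nat \<Rightarrow> real) \<Rightarrow> pdtree \<Rightarrow> (nat \<Rightarrow> node) \<Rightarrow> bool" where
  "revenue_order \<rho> t \<tau> \<longleftrightarrow>
     bij_betw \<tau> {1..card (leaves t)} (leaves t) \<and>
     (\<forall>i\<in>{1..card (leaves t)}. \<forall>j\<in>{1..card (leaves t)}.
        i \<le> j \<longrightarrow> revenue \<rho> t (\<tau> i) \<ge> revenue \<rho> t (\<tau> j))"

datatype event = Event_A node | Event_B node | Event_C

text \<open>
  The function \<open>cause\<close> is the map \<open>f\<close> of the algorithm, meaningful only on \<open>events\<close>. The flag
  \<open>halted\<close> records that the algorithm has terminated; later iterations then do nothing.
\<close>

record greedy_state =
  sol :: "node \<Rightarrow> real"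
  events :: "event set"
  cause :: "event \<Rightarrow> node"
  halted :: bool

definition greedy_init :: greedy_state where
  "greedy_init = \<lparr>sol = (\<lambda>_. 0), events = {}, cause = (\<lambda>_. undefined), halted = False\<rparr>"

definition slack_C :: "(nat \<Rightarrow> node) \<Rightarrow> nat \<Rightarrow> (node \<Rightarrow> real) \<Rightarrow> real" where
  "slack_C \<tau> i y = 1 - (\<Sum>j\<in>{1..<i}. y (\<tau> j))"

definition slack ::
    "(nat \<Rightarrow> real) \<Rightarrow> pdtree \<Rightarrow> (nat \<Rightarrow> node) \<Rightarrow> nat \<Rightarrow> (node \<Rightarrow> real) \<Rightarrow> node \<Rightarrow> real" where
  "slack x t \<tau> i y s =
     (if s \<in> LS t (\<tau> i)
      then x (split_label t s) - (\<Sum>j \<in> {j\<in>{1..<i}. \<tau> j \<in> left_leaves t s}. y (\<tau> j))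
      else 1 - x (split_label t s) - (\<Sum>j \<in> {j\<in>{1..<i}. \<tau> j \<in> right_leaves t s}. y (\<tau> j)))"

text \<open>
  In a step, the case distinction on \<open>S = {}\<close> implements the convention that the minimum of the
  empty set is infinite. The splits on the path to a leaf have pairwise different depths, so the
  minimizer \<open>sstar\<close> is unique.
\<close>

definition primal_step ::
    "(nat \<Rightarrow> real) \<Rightarrow> pdtree \<Rightarrow> (nat \<Rightarrow> node) \<Rightarrow> nat \<Rightarrow> greedy_state \<Rightarrow> greedy_state" where
  "primal_step x t \<tau> i \<sigma> =
     (if halted \<sigma> then \<sigma>
      else
        let S = LS t (\<tau> i) \<union> RS t (\<tau> i);
            q = slack x t \<tau> i (sol \<sigma>);
            qC = slack_C \<tau> i (sol \<sigma>);
            qstar = (if S = {} then qC else min qC (Min (q ` S)));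
            \<sigma>' = \<sigma>\<lparr>sol := (sol \<sigma>)(\<tau> i := qstar)\<rparr>
        in
          if qstar = qC then
            \<sigma>'\<lparr>events := insert Event_C (events \<sigma>),
               cause := (cause \<sigma>)(Event_C := \<tau> i),
               halted := True\<rparr>
          else
            let sstar = (ARG_MIN depth s. s \<in> S \<and> q s = Min (q ` S));
                e = (if sstar \<in> LS t (\<tau> i) then Event_A sstar else Event_B sstar)
            in
              if e \<in> events \<sigma> then \<sigma>'
              else \<sigma>'\<lparr>events := insert e (events \<sigma>), cause := (cause \<sigma>)(e := \<tau> i)\<rparr>)"

definition primal_greedy ::
    "(nat \<Rightarrow> real) \<Rightarrow> pdtree \<Rightarrow> (nat \<Rightarrow> node) \<Rightarrow>
      (node \<Rightarrow> real) \<times> event set \<times> (event \<Rightarrow> node)" where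
  "primal_greedy x t \<tau> =
     (let \<sigma> = fold (primal_step x t \<tau>) [1..<Suc (card (leaves t))] greedy_init
      in (sol \<sigma>, events \<sigma>, cause \<sigma>))"


subsection \<open>The dual greedy algorithm\<close>

definition dual_value ::
    "(nat \<Rightarrow> real) \<Rightarrow> pdtree \<Rightarrow> event set \<Rightarrow> real \<Rightarrow> nat \<Rightarrow>
      (node \<Rightarrow> real) \<Rightarrow> (node \<Rightarrow> real) \<Rightarrow> node \<Rightarrow> real" where
  "dual_value \<rho> t E \<gamma> d \<alpha> \<beta> l =
     revenue \<rho> t l - \<gamma>
       - (\<Sum>s' \<in> {s' \<in> LS t l. Event_A s' \<in> E \<and> depth s' < d}. \<alpha> s')
       - (\<Sum>s' \<in> {s' \<in> RS t l. Event_B s' \<in> E \<and> depth s' < d}. \<beta> s')"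

text \<open>
  All splits of depth \<open>d\<close> are processed simultaneously: the assigned values depend only on the
  variables of splits of smaller depth, so the order within one depth is irrelevant.
\<close>

definition dual_step ::
    "(nat \<Rightarrow> real) \<Rightarrow> pdtree \<Rightarrow> event set \<Rightarrow> (event \<Rightarrow> node) \<Rightarrow> real \<Rightarrow> nat \<Rightarrow>
      (node \<Rightarrow> real) \<times> (node \<Rightarrow> real) \<Rightarrow> (node \<Rightarrow> real) \<times> (node \<Rightarrow> real)" where
  "dual_step \<rho> t E f \<gamma> d = (\<lambda>(\<alpha>, \<beta>).
     ((\<lambda>s. if s \<in> splits t \<and> depth s = d \<and> Event_A s \<in> E
           then dual_value \<rho> t E \<gamma> d \<alpha> \<beta> (f (Event_A s)) else \<alpha> s),
      (\<lambda>s. if s \<in> splits t \<and> depth s = d \<and> Event_B s \<in> E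
           then dual_value \<rho> t E \<gamma> d \<alpha> \<beta> (f (Event_B s)) else \<beta> s)))"

definition dual_greedy ::
    "(nat \<Rightarrow> real) \<Rightarrow> pdtree \<Rightarrow> event set \<Rightarrow> (event \<Rightarrow> node) \<Rightarrow>
      (node \<Rightarrow> real) \<times> (node \<Rightarrow> real) \<times> real" where
  "dual_greedy \<rho> t E f =
     (let \<gamma> = revenue \<rho> t (f Event_C);
          (\<alpha>, \<beta>) = fold (dual_step \<rho> t E f \<gamma>) [1..<Suc (max_depth t)] ((\<lambda>_. 0), (\<lambda>_. 0))
      in (\<alpha>, \<beta>, \<gamma>))"

end

theory Submission
  imports Defs
begin

text \<open>
  The constraint that the leaves carry total weight one looks like one more edge constraint. To make
  it one, every edge is identified with the node at its lower end: the left edge of a split \<open>s\<close> is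
  \<open>s @ [Left]\<close>, its right edge is \<open>s @ [Right]\<close>, and the root \<open>[]\<close> stands for an extra edge of
  capacity \<open>1\<close> entering the tree from above. Events, dual prices and slacks are then all indexed by
  nodes, the event \<open>C\<close> is the event of the root, and the load of a node is the total weight of
  the leaves below it. One greedy step gives a leaf the smallest gap between capacity and load
  along its path, and marks the topmost node that attains this minimum.

  Three facts about the marked nodes make complementary slackness work. A marked node is tight and
  stays tight. If one marked node lies above another, its cause was processed later and hence has
  at most the same revenue: while the upper node is tight, no lower node can be
  selected, by the tie-breaking rule. And every processed leaf has a marked node on its path whose
  cause was processed no later than the leaf; if the leaf got positive weight, no marked node on its
  path was marked earlier. These facts are kept in the locale \<open>greedy_invariant\<close>.

  The recursion of the dual algorithm says that the prices on the path to a marked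
  node sum to the revenue of its cause (\<open>dual_greedy_path_sum\<close>), so the path sum of an arbitrary
  node is the revenue of the cause of the deepest marked node above it. Monotonicity of causes now
  gives nonnegative prices, marked nodes on the paths of processed leaves give dual feasibility,
  and for a leaf of positive weight both inequalities meet. Prices vanish off the marked nodes, which
  are tight, and weak duality finishes the argument.

  It remains to see that the root does get marked. Otherwise every leaf would be below some tight
  node while the root is not full; but the two edges of a split have capacities
  adding up to \<open>1\<close>, so tightness propagates up to the root (\<open>load_ge_capacity_if_covered\<close>).
\<close>

section \<open>Edges of a tree, capacities and loads\<close>

definition nodes :: "pdtree \<Rightarrow> node set" where
  "nodes t = splits t \<union> leaves t"

text \<open>
  Capacities, events and prices are each given by three separate pieces, for left edges, right edges
  and the root. Combining the pieces turns them into single functions of the lower end of an edge.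
\<close>

definition edge_case :: "'a \<Rightarrow> (node \<Rightarrow> 'a) \<Rightarrow> (node \<Rightarrow> 'a) \<Rightarrow> node \<Rightarrow> 'a" where
  "edge_case c a b p =
     (if p = [] then c else if last p = Left then a (butlast p) else b (butlast p))"

lemma edge_case_simps [simp]:
  "edge_case c a b [] = c"
  "edge_case c a b (s @ [Left]) = a s"
  "edge_case c a b (s @ [Right]) = b s"
  by (simp_all add: edge_case_def)

abbreviation capacity :: "(nat \<Rightarrow> real) \<Rightarrow> pdtree \<Rightarrow> node \<Rightarrow> real" where
  "capacity x t \<equiv> edge_case 1 (\<lambda>s. x (split_label t s)) (\<lambda>s. 1 - x (split_label t s))"

abbreviation event_at :: "node \<Rightarrow> event" where
  "event_at \<equiv> edge_case Event_C Event_A Event_B"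

definition load :: "pdtree \<Rightarrow> (node \<Rightarrow> real) \<Rightarrow> node \<Rightarrow> real" where
  "load t y p = (\<Sum>l\<in>{l \<in> leaves t. prefix p l}. y l)"

lemma node_snoc_cases [case_names Root Left Right]:
  obtains "p = []" | s where "p = s @ [Left]" | s where "p = s @ [Right]"
  by (metis rev_exhaust side.exhaust)

lemma event_at_inject [simp]: "event_at p = event_at q \<longleftrightarrow> p = q"
  by (cases p rule: node_snoc_cases; cases q rule: node_snoc_cases) simp_all

lemma finite_nodes [simp]: "finite (nodes t)"
  by (simp add: nodes_def)

lemma root_in_nodes [simp]: "[] \<in> nodes t"
  by (cases t) (auto simp: nodes_def)

lemma leaf_in_nodes: "l \<in> leaves t \<Longrightarrow> l \<in> nodes t"
  by (simp add: nodes_def)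

lemma nodes_Split: "nodes (Split v l r) = insert [] ((#) Left ` nodes l \<union> (#) Right ` nodes r)"
  by (auto simp: nodes_def)

lemma split_not_leaf: "s \<in> splits t \<Longrightarrow> s \<notin> leaves t"
  by (induction t arbitrary: s) auto

lemma child_in_nodes_iff [simp]: "s @ [d] \<in> nodes t \<longleftrightarrow> s \<in> splits t"
proof (induction t arbitrary: s)
  case (Leaf c)
  then show ?case by (simp add: nodes_def)
next
  case (Split v l r)
  show ?case
  proof (cases s)
    case Nil
    then show ?thesis by (cases d) (simp_all add: nodes_Split image_iff)
  next
    case (Cons a s')
    then show ?thesis by (cases a) (auto simp: nodes_Split Split)
  qed
qed

lemma split_in_nodes: "s \<in> splits t \<Longrightarrow> s \<in> nodes t"
  by (simp add: nodes_def)

lemma prefix_in_nodes: "p \<in> nodes t \<Longrightarrow> prefix q p \<Longrightarrow> q \<in> nodes t"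
proof (induction p rule: rev_induct)
  case Nil
  then show ?case by simp
next
  case (snoc d p)
  from snoc.prems(1) have "p \<in> nodes t"
    by (simp add: split_in_nodes)
  with snoc show ?case by auto
qed

lemma nodes_eq: "nodes t = insert [] ((\<lambda>s. s @ [Left]) ` splits t \<union> (\<lambda>s. s @ [Right]) ` splits t)"
proof (intro set_eqI)
  fix p
  show "p \<in> nodes t \<longleftrightarrow>
      p \<in> insert [] ((\<lambda>s. s @ [Left]) ` splits t \<union> (\<lambda>s. s @ [Right]) ` splits t)"
    by (cases p rule: node_snoc_cases) auto
qed

text \<open>
  Going from the leaves towards the root with the tree kept fixed avoids relating the loads and
  capacities of a subtree to those of the whole tree.
\<close>

lemma nodes_induct [consumes 1, case_names leaf split]:
  assumes "p \<in> nodes t"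
    and "\<And>l. l \<in> leaves t \<Longrightarrow> Q l"
    and "\<And>s. s \<in> splits t \<Longrightarrow> Q (s @ [Left]) \<Longrightarrow> Q (s @ [Right]) \<Longrightarrow> Q s"
  shows "Q p"
  using assms
proof (induction t arbitrary: p Q)
  case (Leaf c)
  then show ?case by (simp add: nodes_def)
next
  case (Split v l r)
  have L: "Q (Left # q)" if "q \<in> nodes l" for q
    using that by (rule Split.IH(1)) (auto intro: Split.prems(2) Split.prems(3))
  have R: "Q (Right # q)" if "q \<in> nodes r" for q
    using that by (rule Split.IH(2)) (auto intro: Split.prems(2) Split.prems(3))
  have "Q []"
    by (rule Split.prems(3)) (simp_all add: L R)
  with L R Split.prems(1) show ?case by (auto simp: nodes_Split)
qed

lemma split_of_edge: "l \<in> leaves t \<Longrightarrow> prefix (s @ [d]) l \<Longrightarrow> s \<in> splits t"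
  using prefix_in_nodes[OF leaf_in_nodes] child_in_nodes_iff by blast

lemma LS_eq: "l \<in> leaves t \<Longrightarrow> LS t l = {s. prefix (s @ [Left]) l}"
  by (auto simp: LS_def left_leaves_def intro: split_of_edge)

lemma RS_eq: "l \<in> leaves t \<Longrightarrow> RS t l = {s. prefix (s @ [Right]) l}"
  by (auto simp: RS_def right_leaves_def intro: split_of_edge)

lemma prefixes_eq:
  assumes "l \<in> leaves t"
  shows "set (prefixes l) = insert [] ((\<lambda>s. s @ [Left]) ` LS t l \<union> (\<lambda>s. s @ [Right]) ` RS t l)"
proof (intro set_eqI)
  fix p
  show "p \<in> set (prefixes l) \<longleftrightarrow>
      p \<in> insert [] ((\<lambda>s. s @ [Left]) ` LS t l \<union> (\<lambda>s. s @ [Right]) ` RS t l)"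
    using assms by (cases p rule: node_snoc_cases) (auto simp: LS_eq RS_eq)
qed

lemma finite_LS [simp]: "finite (LS t l)" and finite_RS [simp]: "finite (RS t l)"
  by (simp_all add: LS_def RS_def)

text \<open>
  Both the set of all nodes and the set of nodes on the path to a leaf have this shape, which
  connects sums over nodes with the separate sums in the objective and the constraints.
\<close>

lemma sum_edges:
  fixes h :: "node \<Rightarrow> real"
  assumes "finite S" "finite S'"
  shows "(\<Sum>p\<in>insert [] ((\<lambda>s. s @ [Left]) ` S \<union> (\<lambda>s. s @ [Right]) ` S'). h p) =
    (\<Sum>s\<in>S. h (s @ [Left])) + (\<Sum>s\<in>S'. h (s @ [Right])) + h []"
proof -
  have "(\<Sum>p\<in>(\<lambda>s. s @ [Left]) ` S \<union> (\<lambda>s. s @ [Right]) ` S'. h p) =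
      (\<Sum>p\<in>(\<lambda>s. s @ [Left]) ` S. h p) + (\<Sum>p\<in>(\<lambda>s. s @ [Right]) ` S'. h p)"
    using assms by (intro sum.union_disjoint) auto
  also have "\<dots> = (\<Sum>s\<in>S. h (s @ [Left])) + (\<Sum>s\<in>S'. h (s @ [Right]))"
    by (simp add: sum.reindex inj_on_def)
  finally show ?thesis
    using assms by (subst sum.insert) auto
qed

lemma load_root: "load t y [] = (\<Sum>l\<in>leaves t. y l)"
  by (simp add: load_def)

lemma load_split:
  assumes "s \<in> splits t"
  shows "load t y s = load t y (s @ [Left]) + load t y (s @ [Right])"
proof -
  have "prefix s l \<longleftrightarrow> prefix (s @ [Left]) l \<or> prefix (s @ [Right]) l" if "l \<in> leaves t" for l
  proof -
    have "l \<noteq> s" using assms that split_not_leaf by blast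
    have "prefix (s @ [Left]) l \<or> prefix (s @ [Right]) l" if "prefix s l"
    proof -
      from that \<open>l \<noteq> s\<close> obtain d zs where "l = s @ d # zs"
        by (metis append_Nil2 neq_Nil_conv prefixE)
      then show ?thesis by (cases d) simp_all
    qed
    then show ?thesis by (blast dest: append_prefixD)
  qed
  then have "{l \<in> leaves t. prefix s l} =
      {l \<in> leaves t. prefix (s @ [Left]) l} \<union> {l \<in> leaves t. prefix (s @ [Right]) l}"
    by blast
  moreover have "{l \<in> leaves t. prefix (s @ [Left]) l} \<inter> {l \<in> leaves t. prefix (s @ [Right]) l} = {}"
    by (auto simp: prefix_def)
  ultimately show ?thesis
    unfolding load_def by (simp add: sum.union_disjoint)
qed

lemma load_update:
  assumes "l \<in> leaves t" and "y l = 0"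
  shows "load t (y(l := q)) p = load t y p + (if prefix p l then q else 0)"
proof (cases "prefix p l")
  case True
  let ?A = "{k \<in> leaves t. prefix p k}"
  have "l \<in> ?A" using assms True by simp
  then show ?thesis
    using True assms(2) by (simp add: load_def sum.remove[of ?A l])
next
  case False
  then show ?thesis
    by (auto simp: load_def intro!: sum.cong)
qed

section \<open>Duality and tight edges\<close>

lemma primal_feasible_iff_load:
  "primal_feasible t x y \<longleftrightarrow>
     load t y [] = 1 \<and> (\<forall>p\<in>nodes t. load t y p \<le> capacity x t p) \<and> (\<forall>l\<in>leaves t. 0 \<le> y l)"
  unfolding primal_feasible_def nodes_eq
  by (auto simp: ball_Un left_leaves_def right_leaves_def load_def)

lemma dual_feasible_iff_price:
  "dual_feasible \<rho> t \<alpha> \<beta> \<gamma> \<longleftrightarrow>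
     (\<forall>l\<in>leaves t. revenue \<rho> t l \<le> (\<Sum>p\<in>set (prefixes l). edge_case \<gamma> \<alpha> \<beta> p)) \<and>
     (\<forall>p\<in>nodes t - {[]}. 0 \<le> edge_case \<gamma> \<alpha> \<beta> p)"
proof -
  have "(\<Sum>p\<in>set (prefixes l). edge_case \<gamma> \<alpha> \<beta> p) = (\<Sum>s\<in>LS t l. \<alpha> s) + (\<Sum>s\<in>RS t l. \<beta> s) + \<gamma>"
    if "l \<in> leaves t" for l
    using that by (simp add: prefixes_eq sum_edges)
  moreover have "(\<forall>p\<in>nodes t - {[]}. 0 \<le> edge_case \<gamma> \<alpha> \<beta> p) \<longleftrightarrow>
      (\<forall>s\<in>splits t. \<alpha> s \<ge> 0 \<and> \<beta> s \<ge> 0)"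
  proof -
    have "nodes t - {[]} = (\<lambda>s. s @ [Left]) ` splits t \<union> (\<lambda>s. s @ [Right]) ` splits t"
      unfolding nodes_eq by auto
    then show ?thesis by (auto simp: ball_Un)
  qed
  ultimately show ?thesis
    unfolding dual_feasible_def by simp
qed

lemma dual_objective_eq:
  "dual_objective t x \<alpha> \<beta> \<gamma> = (\<Sum>p\<in>nodes t. capacity x t p * edge_case \<gamma> \<alpha> \<beta> p)"
  by (simp add: dual_objective_def nodes_eq sum_edges)

text \<open>
  The double counting behind weak duality: a node \<open>p\<close> is on the path to a leaf \<open>l\<close> exactly when \<open>l\<close>
  contributes to the load of \<open>p\<close>.
\<close>

lemma sum_path_prices:
  "(\<Sum>l\<in>leaves t. (\<Sum>p\<in>set (prefixes l). w p) * y l) = (\<Sum>p\<in>nodes t. load t y p * w p)"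
proof -
  have "(\<Sum>l\<in>leaves t. (\<Sum>p\<in>set (prefixes l). w p) * y l) =
      (\<Sum>l\<in>leaves t. \<Sum>p\<in>{p \<in> nodes t. prefix p l}. w p * y l)"
  proof (intro sum.cong refl)
    fix l assume "l \<in> leaves t"
    then have "set (prefixes l) = {p \<in> nodes t. prefix p l}"
      by (auto intro: prefix_in_nodes leaf_in_nodes)
    then show "(\<Sum>p\<in>set (prefixes l). w p) * y l = (\<Sum>p\<in>{p \<in> nodes t. prefix p l}. w p * y l)"
      by (simp add: sum_distrib_right)
  qed
  also have "\<dots> = (\<Sum>p\<in>nodes t. \<Sum>l\<in>{l \<in> leaves t. prefix p l}. w p * y l)"
    by (rule sum.swap_restrict) simp_all
  also have "\<dots> = (\<Sum>p\<in>nodes t. load t y p * w p)"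
    by (simp add: load_def sum_distrib_left mult.commute)
  finally show ?thesis .
qed

lemma weak_duality:
  assumes y: "primal_feasible t x y" and d: "dual_feasible \<rho> t \<alpha> \<beta> \<gamma>"
  shows "primal_objective \<rho> t y \<le> dual_objective t x \<alpha> \<beta> \<gamma>"
proof -
  let ?w = "edge_case \<gamma> \<alpha> \<beta>"
  have "primal_objective \<rho> t y \<le> (\<Sum>l\<in>leaves t. (\<Sum>p\<in>set (prefixes l). ?w p) * y l)"
    using y d unfolding primal_objective_def
    by (intro sum_mono mult_right_mono)
      (simp_all add: dual_feasible_iff_price primal_feasible_iff_load)
  also have "\<dots> = (\<Sum>p\<in>nodes t. load t y p * ?w p)"
    by (rule sum_path_prices)
  also have "\<dots> \<le> (\<Sum>p\<in>nodes t. capacity x t p * ?w p)"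
  proof (rule sum_mono)
    fix p assume "p \<in> nodes t"
    then show "load t y p * ?w p \<le> capacity x t p * ?w p"
      using y d
      by (cases "p = []")
        (auto simp: dual_feasible_iff_price primal_feasible_iff_load intro!: mult_right_mono)
  qed
  finally show ?thesis by (simp add: dual_objective_eq)
qed

text \<open>
  Under the slackness conditions both inequalities in the proof of weak duality are
  equalities.
\<close>

lemma complementary_slackness_optimal:
  assumes y: "primal_feasible t x y" and d: "dual_feasible \<rho> t \<alpha> \<beta> \<gamma>"
    and leaf: "\<And>l. l \<in> leaves t \<Longrightarrow> 0 < y l \<Longrightarrow>
        (\<Sum>p\<in>set (prefixes l). edge_case \<gamma> \<alpha> \<beta> p) = revenue \<rho> t l"
    and edge: "\<And>p. p \<in> nodes t \<Longrightarrow> edge_case \<gamma> \<alpha> \<beta> p \<noteq> 0 \<Longrightarrow> load t y p = capacity x t p"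
  shows "primal_optimal \<rho> t x y" and "dual_optimal \<rho> t x \<alpha> \<beta> \<gamma>"
proof -
  let ?w = "edge_case \<gamma> \<alpha> \<beta>"
  have "primal_objective \<rho> t y = (\<Sum>l\<in>leaves t. (\<Sum>p\<in>set (prefixes l). ?w p) * y l)"
    unfolding primal_objective_def
  proof (rule sum.cong)
    fix l assume l: "l \<in> leaves t"
    then have "y l = 0 \<or> 0 < y l"
      using y unfolding primal_feasible_iff_load by force
    with leaf[OF l] show "revenue \<rho> t l * y l = (\<Sum>p\<in>set (prefixes l). ?w p) * y l" by auto
  qed simp
  also have "\<dots> = (\<Sum>p\<in>nodes t. load t y p * ?w p)"
    by (rule sum_path_prices)
  also have "\<dots> = (\<Sum>p\<in>nodes t. capacity x t p * ?w p)"
  proof (rule sum.cong)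
    fix p assume "p \<in> nodes t"
    with edge show "load t y p * ?w p = capacity x t p * ?w p" by fastforce
  qed simp
  finally have "primal_objective \<rho> t y = dual_objective t x \<alpha> \<beta> \<gamma>"
    by (simp add: dual_objective_eq)
  then show "primal_optimal \<rho> t x y" "dual_optimal \<rho> t x \<alpha> \<beta> \<gamma>"
    using weak_duality[OF _ d, of x] weak_duality[OF y, of \<rho>] y d
    by (simp_all add: primal_optimal_def dual_optimal_def)
qed

lemma capacity_bounds:
  assumes "p \<in> nodes t" and "\<forall>s\<in>splits t. 0 \<le> x (split_label t s) \<and> x (split_label t s) \<le> 1"
  shows "0 \<le> capacity x t p" and "capacity x t p \<le> 1"
  using assms by (cases p rule: node_snoc_cases; simp)+

text \<open>
  If every path from \<open>p\<close> down to a leaf meets a tight node, then \<open>p\<close> is full. Either \<open>p\<close> is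
  tight itself, or both children of \<open>p\<close> satisfy the same hypothesis and their capacities add up to
  \<open>1\<close>, which is at least the capacity of any node. A leaf that is not tight cannot satisfy the
  hypothesis.
\<close>

lemma load_ge_capacity_if_covered:
  assumes x: "\<forall>s\<in>splits t. 0 \<le> x (split_label t s) \<and> x (split_label t s) \<le> 1"
    and "p \<in> nodes t"
    and "\<And>l. l \<in> leaves t \<Longrightarrow> prefix p l \<Longrightarrow>
        \<exists>q. prefix p q \<and> prefix q l \<and> load t y q = capacity x t q"
  shows "capacity x t p \<le> load t y p"
  using assms(2,3)
proof (induction rule: nodes_induct)
  case (leaf l)
  then obtain q where "prefix l q" "prefix q l" "load t y q = capacity x t q"
    by blast
  then show ?case by (metis order_refl prefix_order.antisym)
next
  case (split s)
  show ?case
  proof (cases "load t y s = capacity x t s")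
    case False
    have "capacity x t (s @ [d]) \<le> load t y (s @ [d])"
      if IH: "(\<And>l. l \<in> leaves t \<Longrightarrow> prefix (s @ [d]) l \<Longrightarrow>
        \<exists>q. prefix (s @ [d]) q \<and> prefix q l \<and> load t y q = capacity x t q)
        \<Longrightarrow> capacity x t (s @ [d]) \<le> load t y (s @ [d])" for d
    proof (rule IH)
      fix l assume l: "l \<in> leaves t" "prefix (s @ [d]) l"
      then obtain q where q: "prefix s q" "prefix q l" "load t y q = capacity x t q"
        using split.prems append_prefixD by blast
      then have "q \<noteq> s" using False by blast
      with q(1) have "length (s @ [d]) \<le> length q"
        by (metis Suc_leI length_append_singleton prefix_length_less prefix_order.le_less)
      with q l(2) have "prefix (s @ [d]) q"
        using prefix_length_prefix by blast
      with q show "\<exists>q. prefix (s @ [d]) q \<and> prefix q l \<and> load t y q = capacity x t q" by blast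
    qed
    from this[OF split.IH(1)] this[OF split.IH(2)]
    have "1 \<le> load t y s"
      using load_split[OF split.hyps, of y] by simp
    moreover have "capacity x t s \<le> 1"
      using split.hyps x by (intro capacity_bounds) (auto simp: nodes_def)
    ultimately show ?thesis by linarith
  qed simp
qed

section \<open>The primal greedy algorithm\<close>

text \<open>
  The situation after the leaves in \<open>P\<close> have been processed. Time does not occur: since leaves are
  processed by decreasing revenue, comparing revenues of causes is all that
  the dual analysis uses. Stated like this, the conditions also survive
  the iterations after the algorithm has terminated.
\<close>

locale greedy_invariant =
  fixes t :: pdtree and x :: "nat \<Rightarrow> real" and r :: "node \<Rightarrow> real" and P :: "node set"
    and y :: "node \<Rightarrow> real" and E :: "event set" and f :: "event \<Rightarrow> node"
  assumes sol_nonneg: "l \<in> leaves t \<Longrightarrow> 0 \<le> y l"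
    and sol_unprocessed: "l \<in> leaves t \<Longrightarrow> l \<notin> P \<Longrightarrow> y l = 0"
    and load_le: "p \<in> nodes t \<Longrightarrow> load t y p \<le> capacity x t p"
    and load_root_less: "Event_C \<notin> E \<Longrightarrow> load t y [] < 1"
    and event_tight: "p \<in> nodes t \<Longrightarrow> event_at p \<in> E \<Longrightarrow> load t y p = capacity x t p"
    and cause_processed: "p \<in> nodes t \<Longrightarrow> event_at p \<in> E \<Longrightarrow> f (event_at p) \<in> P"
    and cause_below: "p \<in> nodes t \<Longrightarrow> event_at p \<in> E \<Longrightarrow> prefix p (f (event_at p))"
    and cause_mono: "q \<in> nodes t \<Longrightarrow> strict_prefix p q \<Longrightarrow> event_at p \<in> E \<Longrightarrow> event_at q \<in> E \<Longrightarrow>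
        r (f (event_at p)) \<le> r (f (event_at q))"
    and processed_blocked: "l \<in> P \<Longrightarrow>
        \<exists>p. prefix p l \<and> event_at p \<in> E \<and> r l \<le> r (f (event_at p))"
    and cause_le_positive: "l \<in> leaves t \<Longrightarrow> 0 < y l \<Longrightarrow> prefix p l \<Longrightarrow> event_at p \<in> E \<Longrightarrow>
        r (f (event_at p)) \<le> r l"

lemma greedy_invariant_init:
  assumes "\<forall>s\<in>splits t. 0 \<le> x (split_label t s) \<and> x (split_label t s) \<le> 1"
  shows "greedy_invariant t x r {} (\<lambda>_. 0) {} f"
  using assms by unfold_locales (simp_all add: load_def capacity_bounds)

text \<open>
  The new leaf \<open>l\<close> receives the smallest gap on its path, attained first at \<open>p\<close>. If
  some node on the path is already marked, hence tight, the gap is \<open>0\<close>, and the strict inequality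
  above \<open>p\<close> shows that no marked node lies strictly above \<open>p\<close>. Marking \<open>p\<close> thus puts it above
  older marks only, whose causes have at least the revenue of \<open>l\<close>.
\<close>

lemma (in greedy_invariant) greedy_invariant_step:
  assumes l: "l \<in> leaves t" "l \<notin> P"
    and order: "\<And>k. k \<in> P \<Longrightarrow> r l \<le> r k"
    and p: "prefix p l"
    and min: "\<And>q. prefix q l \<Longrightarrow> capacity x t p - load t y p \<le> capacity x t q - load t y q"
    and tie: "\<And>q. strict_prefix q p \<Longrightarrow> capacity x t p - load t y p < capacity x t q - load t y q"
  shows "greedy_invariant t x r (insert l P) (y(l := capacity x t p - load t y p))
    (insert (event_at p) E) (if event_at p \<in> E then f else f(event_at p := l))"
proof -
  define g where "g = capacity x t p - load t y p"
  define y' where "y' = y(l := g)"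
  define E' where "E' = insert (event_at p) E"
  define f' where "f' = (if event_at p \<in> E then f else f(event_at p := l))"
  have node: "q \<in> nodes t" if "prefix q l" for q
    using prefix_in_nodes[OF leaf_in_nodes] l that by blast
  have y'_simps: "y' l = g" "\<And>k. k \<noteq> l \<Longrightarrow> y' k = y k"
    by (simp_all add: y'_def)
  have load': "load t y' q = load t y q + (if prefix q l then g else 0)" for q
    unfolding y'_def using l sol_unprocessed by (intro load_update) auto
  have g_nonneg: "0 \<le> g" using load_le[OF node[OF p]] by (simp add: g_def)
  have g_le: "g \<le> capacity x t q - load t y q" if "prefix q l" for q
    using min[OF that] by (simp add: g_def)
  (* Weight is added only while no node on the path is marked. *)
  have old: "g = 0" if "prefix q l" "event_at q \<in> E" for q
    using g_le[OF that(1)] event_tight[OF node[OF that(1)] that(2)] g_nonneg by simp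
  have E'_iff: "event_at q \<in> E' \<longleftrightarrow> event_at q \<in> E \<or> q = p" for q
    by (auto simp: E'_def)
  have f_old: "f' (event_at q) = f (event_at q)" if "event_at q \<in> E" for q
    using that by (auto simp: f'_def)
  have f_new: "f' (event_at p) = l" if "event_at p \<notin> E"
    using that by (simp add: f'_def)
  have "greedy_invariant t x r (insert l P) y' E' f'"
  proof
    fix k assume "k \<in> leaves t"
    then show "0 \<le> y' k" using g_nonneg sol_nonneg by (simp add: y'_def)
  next
    fix k assume "k \<in> leaves t" "k \<notin> insert l P"
    then show "y' k = 0" using sol_unprocessed by (simp add: y'_def)
  next
    fix q assume "q \<in> nodes t"
    then show "load t y' q \<le> capacity x t q"
      using load'[of q] load_le[of q] g_le[of q] by (cases "prefix q l") simp_all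
  next
    assume "Event_C \<notin> E'"
    then have "strict_prefix [] p" by (cases p) (auto simp: E'_def)
    from tie[OF this] show "load t y' [] < 1" by (simp add: load' g_def)
  next
    fix q assume q: "q \<in> nodes t" "event_at q \<in> E'"
    show "load t y' q = capacity x t q"
    proof (cases "event_at q \<in> E")
      case True
      then show ?thesis using event_tight[OF q(1)] old[of q] by (simp add: load')
    next
      case False
      then show ?thesis using q(2) p by (simp add: E'_iff load' g_def)
    qed
    show "f' (event_at q) \<in> insert l P"
    proof (cases "event_at q \<in> E")
      case True
      then show ?thesis using cause_processed[OF q(1)] by (simp add: f_old)
    next
      case False
      then show ?thesis using q(2) f_new by (simp add: E'_iff)
    qed
    show "prefix q (f' (event_at q))"
    proof (cases "event_at q \<in> E")
      case True
      then show ?thesis using cause_below[OF q(1)] by (simp add: f_old)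
    next
      case False
      then show ?thesis using q(2) f_new p by (simp add: E'_iff)
    qed
  next
    fix q q' assume q: "q' \<in> nodes t" "strict_prefix q q'" "event_at q \<in> E'" "event_at q' \<in> E'"
    have "q \<noteq> q'" using q(2) by auto
    with q(3,4) consider "event_at q \<in> E" "event_at q' \<in> E"
      | "q = p" "event_at p \<notin> E" "event_at q' \<in> E"
      | "q' = p" "event_at p \<notin> E" "event_at q \<in> E"
      unfolding E'_iff by blast
    then show "r (f' (event_at q)) \<le> r (f' (event_at q'))"
    proof cases
      case 1
      then show ?thesis using f_old cause_mono[OF q(1,2)] by simp
    next
      case 2
      then show ?thesis
        using f_old[of q'] f_new order[OF cause_processed[OF q(1)]] by simp
    next
      case 3
      then have "strict_prefix q p" using q(2) by simp
      moreover from this have "prefix q l"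
        using p by (meson prefix_order.less_imp_le prefix_order.trans)
      ultimately have False
        using 3 tie[of q] old[of q] event_tight[OF node, of q] by (simp add: g_def)
      then show ?thesis ..
    qed
  next
    fix k assume k: "k \<in> insert l P"
    show "\<exists>q. prefix q k \<and> event_at q \<in> E' \<and> r k \<le> r (f' (event_at q))"
    proof (cases "k = l")
      case True
      have "r l \<le> r (f' (event_at p))"
      proof (cases "event_at p \<in> E")
        case True
        then show ?thesis
          using order[OF cause_processed[OF node[OF p]]] by (simp add: f_old)
      next
        case False
        then show ?thesis by (simp add: f_new)
      qed
      with True p E'_iff show ?thesis by blast
    next
      case False
      with k obtain q where "prefix q k" "event_at q \<in> E" "r k \<le> r (f (event_at q))"
        using processed_blocked[of k] by blast
      then show ?thesis using f_old[of q] E'_iff[of q] by (intro exI[of _ q]) simp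
    qed
  next
    fix k q assume k: "k \<in> leaves t" "0 < y' k" "prefix q k" "event_at q \<in> E'"
    show "r (f' (event_at q)) \<le> r k"
    proof (cases "event_at q \<in> E")
      case True
      with k old[of q] have "k \<noteq> l" by (auto simp: y'_simps)
      with k True cause_le_positive[of k q] f_old show ?thesis by (simp add: y'_simps)
    next
      case False
      with k have "q = p" by (simp add: E'_iff)
      moreover have "r l \<le> r k"
        using k order[of k] sol_unprocessed[of k] by (cases "k = l") (auto simp: y'_simps)
      ultimately show ?thesis using False f_new by simp
    qed
  qed
  then show ?thesis
    by (simp only: y'_def E'_def f'_def g_def)
qed

text \<open>
  After termination a leaf counts as processed without any change of state: the marked root lies on
  its path, and the cause of that mark came earlier.
\<close>

lemma (in greedy_invariant) greedy_invariant_step_full: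
  assumes "Event_C \<in> E" and order: "\<And>k. k \<in> P \<Longrightarrow> r l \<le> r k"
  shows "greedy_invariant t x r (insert l P) y E f"
proof -
  have "f (event_at []) \<in> P" using assms by (intro cause_processed) simp_all
  then have "prefix [] l \<and> event_at [] \<in> E \<and> r l \<le> r (f (event_at []))"
    using assms by simp
  then have "\<exists>p. prefix p k \<and> event_at p \<in> E \<and> r k \<le> r (f (event_at p))" if "k \<in> insert l P" for k
    using that processed_blocked by blast
  then show ?thesis
    using load_root_less
    by unfold_locales
      (blast intro: sol_nonneg sol_unprocessed load_le event_tight cause_processed
          cause_below cause_mono cause_le_positive)+
qed

lemma sum_processed:
  assumes "inj_on \<tau> {1..<i}" "finite L" "\<And>l. l \<in> L \<Longrightarrow> l \<notin> \<tau> ` {1..<i} \<Longrightarrow> y l = 0"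
  shows "(\<Sum>j\<in>{j \<in> {1..<i}. \<tau> j \<in> L}. y (\<tau> j)) = (\<Sum>l\<in>L. y l)"
proof -
  have "(\<Sum>j\<in>{j \<in> {1..<i}. \<tau> j \<in> L}. y (\<tau> j)) = (\<Sum>l\<in>\<tau> ` {j \<in> {1..<i}. \<tau> j \<in> L}. y l)"
    by (subst sum.reindex) (auto intro: inj_on_subset[OF assms(1)])
  also have "\<tau> ` {j \<in> {1..<i}. \<tau> j \<in> L} = L \<inter> \<tau> ` {1..<i}"
    by auto
  also have "(\<Sum>l\<in>L \<inter> \<tau> ` {1..<i}. y l) = (\<Sum>l\<in>L. y l)"
    using assms(2,3) by (intro sum.mono_neutral_left) auto
  finally show ?thesis .
qed

text \<open>
  A step of the algorithm in terms of nodes: the root enters the minimization on the same footing as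
  the edges on the path. Preferring \<open>C\<close> when \<open>q\<^sup>*\<close> equals \<open>q\<^sub>C\<close> is the same rule as
  preferring small depth among the splits, since the root is the shortest prefix.
\<close>

lemma primal_step_edge:
  assumes "\<not> halted \<sigma>" and l: "\<tau> i \<in> leaves t"
    and inj: "inj_on \<tau> {1..<i}" and sub: "\<tau> ` {1..<i} \<subseteq> leaves t"
    and zero: "\<And>l. l \<in> leaves t \<Longrightarrow> l \<notin> \<tau> ` {1..<i} \<Longrightarrow> sol \<sigma> l = 0"
  obtains p where "prefix p (\<tau> i)"
    and "\<And>q. prefix q (\<tau> i) \<Longrightarrow>
      capacity x t p - load t (sol \<sigma>) p \<le> capacity x t q - load t (sol \<sigma>) q"
    and "\<And>q. strict_prefix q p \<Longrightarrow>
      capacity x t p - load t (sol \<sigma>) p < capacity x t q - load t (sol \<sigma>) q"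
    and "sol (primal_step x t \<tau> i \<sigma>) = (sol \<sigma>)(\<tau> i := capacity x t p - load t (sol \<sigma>) p)"
    and "Event_C \<notin> events \<sigma> \<Longrightarrow> events (primal_step x t \<tau> i \<sigma>) = insert (event_at p) (events \<sigma>)"
    and "Event_C \<notin> events \<sigma> \<Longrightarrow> cause (primal_step x t \<tau> i \<sigma>) =
      (if event_at p \<in> events \<sigma> then cause \<sigma> else (cause \<sigma>)(event_at p := \<tau> i))"
    and "halted (primal_step x t \<tau> i \<sigma>) \<longleftrightarrow> p = []"
proof -
  define y where "y = sol \<sigma>"
  define gap where "gap p = capacity x t p - load t y p" for p
  define S where "S = LS t (\<tau> i) \<union> RS t (\<tau> i)"
  define q where "q = slack x t \<tau> i y"
  define qC where "qC = slack_C \<tau> i y"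
  define qstar where "qstar = (if S = {} then qC else min qC (Min (q ` S)))"
  have S_iff: "s \<in> S \<longleftrightarrow> (\<exists>d. prefix (s @ [d]) (\<tau> i))" for s
  proof
    assume "\<exists>d. prefix (s @ [d]) (\<tau> i)"
    then obtain d where "prefix (s @ [d]) (\<tau> i)" ..
    then show "s \<in> S" unfolding S_def LS_eq[OF l] RS_eq[OF l] by (cases d) simp_all
  qed (auto simp: S_def LS_eq[OF l] RS_eq[OF l])
  have finS: "finite S" by (simp add: S_def)
  have y0: "y l = 0" if "l \<in> leaves t" "l \<notin> \<tau> ` {1..<i}" for l
    using zero that by (simp add: y_def)
  have one_side: "\<not> prefix (s @ [Left]) (\<tau> i)" if "prefix (s @ [Right]) (\<tau> i)" for s
    using that by (auto simp: prefix_def)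
  have q_gap: "q s = gap (s @ [d])" if "prefix (s @ [d]) (\<tau> i)" for s d
  proof (cases d)
    case Left
    have "(\<Sum>j\<in>{j \<in> {1..<i}. \<tau> j \<in> left_leaves t s}. y (\<tau> j)) = load t y (s @ [Left])"
      unfolding load_def left_leaves_def[symmetric]
      using inj y0 by (intro sum_processed) (auto simp: left_leaves_def)
    with Left that show ?thesis by (simp add: q_def slack_def gap_def LS_eq[OF l])
  next
    case Right
    have "(\<Sum>j\<in>{j \<in> {1..<i}. \<tau> j \<in> right_leaves t s}. y (\<tau> j)) = load t y (s @ [Right])"
      unfolding load_def right_leaves_def[symmetric]
      using inj y0 by (intro sum_processed) (auto simp: right_leaves_def)
    with Right that one_side[of s] show ?thesis by (simp add: q_def slack_def gap_def LS_eq[OF l])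
  qed
  have qC_gap: "qC = gap []"
  proof -
    have "{1..<i} = {j \<in> {1..<i}. \<tau> j \<in> leaves t}" using sub by auto
    then have "(\<Sum>j\<in>{1..<i}. y (\<tau> j)) = load t y []"
      using sum_processed[OF inj, of "leaves t" y] y0 by (simp add: load_root)
    then show ?thesis by (simp add: qC_def slack_C_def gap_def)
  qed
  have step: "primal_step x t \<tau> i \<sigma> =
     (let \<sigma>' = \<sigma>\<lparr>sol := y(\<tau> i := qstar)\<rparr> in
          if qstar = qC then
            \<sigma>'\<lparr>events := insert Event_C (events \<sigma>),
               cause := (cause \<sigma>)(Event_C := \<tau> i),
               halted := True\<rparr>
          else
            let sstar = (ARG_MIN depth s. s \<in> S \<and> q s = Min (q ` S));
                e = (if sstar \<in> LS t (\<tau> i) then Event_A sstar else Event_B sstar)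
            in
              if e \<in> events \<sigma> then \<sigma>'
              else \<sigma>'\<lparr>events := insert e (events \<sigma>), cause := (cause \<sigma>)(e := \<tau> i)\<rparr>)"
    using assms(1) by (simp add: primal_step_def Let_def S_def q_def qC_def qstar_def y_def)
  show thesis
  proof (cases "qstar = qC")
    case True
    have min: "gap [] \<le> gap p" if "prefix p (\<tau> i)" for p
    proof (cases p rule: rev_cases)
      case (snoc s d)
      with that have "s \<in> S" using S_iff by blast
      then have "qstar \<le> q s" using finS by (auto simp: qstar_def min.coboundedI2)
      with True show ?thesis using q_gap[of s d] qC_gap that snoc by simp
    qed simp
    show thesis
      by (rule that[of "[]"])
        (use True qC_gap min in \<open>simp_all add: step Let_def gap_def y_def\<close>)
  next
    case False
    then have "S \<noteq> {}" by (auto simp: qstar_def)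
    with False have qs: "qstar = Min (q ` S)" "Min (q ` S) < qC"
      by (auto simp: qstar_def min_def split: if_splits)
    define s where "s = (ARG_MIN depth s. s \<in> S \<and> q s = Min (q ` S))"
    have "Min (q ` S) \<in> q ` S" using \<open>S \<noteq> {}\<close> finS by simp
    then obtain s0 where s0: "s0 \<in> S \<and> q s0 = Min (q ` S)" by force
    from arg_min_nat_lemma[of "\<lambda>s. s \<in> S \<and> q s = Min (q ` S)" s0 depth, OF s0]
    have s: "s \<in> S" "q s = Min (q ` S)"
      and depth: "\<And>s'. s' \<in> S \<Longrightarrow> q s' = Min (q ` S) \<Longrightarrow> depth s \<le> depth s'"
      unfolding s_def by auto
    from s(1) obtain d where d: "prefix (s @ [d]) (\<tau> i)" using S_iff by blast
    define p where "p = s @ [d]"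
    have gp: "gap p = qstar" using q_gap[OF d] s(2) qs by (simp add: p_def)
    have min: "gap p \<le> gap p' \<and> (length p' < length p \<longrightarrow> gap p < gap p')"
      if "prefix p' (\<tau> i)" for p'
    proof (cases p' rule: rev_cases)
      case Nil
      then show ?thesis using gp qs qC_gap by simp
    next
      case (snoc s' d')
      with that have s': "s' \<in> S" "q s' = gap p'" using S_iff q_gap[of s' d'] by auto
      then have "Min (q ` S) \<le> gap p'" using finS by (auto simp flip: s'(2))
      moreover have "length p \<le> length p'" if "gap p' = Min (q ` S)"
        using depth[of s'] s' that snoc by (simp add: depth_def p_def)
      ultimately show ?thesis using gp qs(1) by force
    qed
    have e: "(if s \<in> LS t (\<tau> i) then Event_A s else Event_B s) = event_at p"
      using d one_side[of s] by (cases d) (auto simp: p_def LS_eq[OF l])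
    show thesis
    proof (rule that[of p])
      show "prefix p (\<tau> i)" using d by (simp add: p_def)
      fix p'
      show "capacity x t p - load t (sol \<sigma>) p \<le> capacity x t p' - load t (sol \<sigma>) p'"
        if "prefix p' (\<tau> i)"
        using min[OF that] by (simp add: gap_def y_def)
      show "capacity x t p - load t (sol \<sigma>) p < capacity x t p' - load t (sol \<sigma>) p'"
        if "strict_prefix p' p"
      proof -
        have "prefix p' (\<tau> i)"
          using that d unfolding p_def by (meson prefix_order.less_imp_le prefix_order.trans)
        with min[of p'] prefix_length_less[OF that] show ?thesis by (simp add: gap_def y_def)
      qed
    qed (use False gp assms(1) in
        \<open>simp_all add: step Let_def s_def[symmetric] e gap_def y_def p_def insert_absorb\<close>)
  qed
qed

text \<open>
  The order of revenues enters here: it makes every leaf processed earlier at least as valuable as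
  the current one.
\<close>

lemma primal_greedy_invariant:
  assumes x: "\<forall>s\<in>splits t. 0 \<le> x (split_label t s) \<and> x (split_label t s) \<le> 1"
    and order: "revenue_order \<rho> t \<tau>"
    and "i \<le> card (leaves t)"
  defines "\<sigma> \<equiv> fold (primal_step x t \<tau>) [1..<Suc i] greedy_init"
  shows "greedy_invariant t x (revenue \<rho> t) (\<tau> ` {1..<Suc i}) (sol \<sigma>) (events \<sigma>) (cause \<sigma>) \<and>
    (halted \<sigma> \<longleftrightarrow> Event_C \<in> events \<sigma>)"
  using assms(3) unfolding \<sigma>_def
proof (induction i)
  case 0
  then show ?case using greedy_invariant_init[OF x] by (simp add: greedy_init_def)
next
  case (Suc i)
  let ?N = "card (leaves t)" and ?r = "revenue \<rho> t"
  let ?i = "Suc i"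
  define \<sigma> where "\<sigma> = fold (primal_step x t \<tau>) [1..<Suc i] greedy_init"
  have fold: "fold (primal_step x t \<tau>) [1..<Suc ?i] greedy_init = primal_step x t \<tau> ?i \<sigma>"
    by (simp add: \<sigma>_def)
  have bij: "bij_betw \<tau> {1..?N} (leaves t)"
    and sorted: "\<And>i j. i \<in> {1..?N} \<Longrightarrow> j \<in> {1..?N} \<Longrightarrow> i \<le> j \<Longrightarrow> ?r (\<tau> j) \<le> ?r (\<tau> i)"
    using order by (auto simp: revenue_order_def)
  have i: "?i \<in> {1..?N}" using Suc.prems by simp
  have sub: "{1..<?i} \<subseteq> {1..?N}" using Suc.prems by auto
  have inj: "inj_on \<tau> {1..?N}" using bij by (simp add: bij_betw_def)
  have l: "\<tau> ?i \<in> leaves t" using bij i by (meson bij_betwE)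
  have P: "\<tau> ` {1..<?i} \<subseteq> leaves t" using bij sub by (auto simp: bij_betw_def)
  have new: "\<tau> ?i \<notin> \<tau> ` {1..<?i}"
    using inj_on_image_mem_iff[OF inj i sub] by simp
  have low: "?r (\<tau> ?i) \<le> ?r k" if "k \<in> \<tau> ` {1..<?i}" for k
    using that sorted[of _ ?i] i by auto
  have image: "\<tau> ` {1..<Suc ?i} = insert (\<tau> ?i) (\<tau> ` {1..<?i})"
    by (auto simp: atLeastLessThanSuc)
  interpret greedy_invariant t x ?r "\<tau> ` {1..<?i}" "sol \<sigma>" "events \<sigma>" "cause \<sigma>"
    using Suc by (simp add: \<sigma>_def)
  have halted: "halted \<sigma> \<longleftrightarrow> Event_C \<in> events \<sigma>"
    using Suc by (simp add: \<sigma>_def)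
  show ?case
  proof (cases "halted \<sigma>")
    case True
    then have "primal_step x t \<tau> ?i \<sigma> = \<sigma>" by (simp add: primal_step_def)
    with True halted greedy_invariant_step_full[OF _ low] show ?thesis
      unfolding fold image by simp
  next
    case False
    then have C: "Event_C \<notin> events \<sigma>" using halted by simp
    obtain p where p: "prefix p (\<tau> ?i)"
      "\<And>q. prefix q (\<tau> ?i) \<Longrightarrow>
        capacity x t p - load t (sol \<sigma>) p \<le> capacity x t q - load t (sol \<sigma>) q"
      "\<And>q. strict_prefix q p \<Longrightarrow>
        capacity x t p - load t (sol \<sigma>) p < capacity x t q - load t (sol \<sigma>) q"
      and step:
      "sol (primal_step x t \<tau> ?i \<sigma>) = (sol \<sigma>)(\<tau> ?i := capacity x t p - load t (sol \<sigma>) p)"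
      "events (primal_step x t \<tau> ?i \<sigma>) = insert (event_at p) (events \<sigma>)"
      "cause (primal_step x t \<tau> ?i \<sigma>) =
        (if event_at p \<in> events \<sigma> then cause \<sigma> else (cause \<sigma>)(event_at p := \<tau> ?i))"
      "halted (primal_step x t \<tau> ?i \<sigma>) \<longleftrightarrow> p = []"
      using primal_step_edge[OF False l inj_on_subset[OF inj sub] P sol_unprocessed, of x] C
      by metis
    have "Event_C = event_at p \<longleftrightarrow> p = []"
      using event_at_inject[of "[]" p] by auto
    then show ?thesis
      unfolding fold image step using greedy_invariant_step[OF l new low p] C by blast
  qed
qed

text \<open>
  Once all leaves are processed, each of them lies below a marked and hence tight node, so the
  root is full; an unmarked root would not be.
\<close>

lemma (in greedy_invariant) greedy_complete:
  assumes x: "\<forall>s\<in>splits t. 0 \<le> x (split_label t s) \<and> x (split_label t s) \<le> 1"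
    and "P = leaves t"
  shows "Event_C \<in> E"
proof (rule ccontr)
  assume "Event_C \<notin> E"
  then have "load t y [] < 1" by (rule load_root_less)
  moreover have "capacity x t [] \<le> load t y []"
  proof (rule load_ge_capacity_if_covered[OF x])
    fix l assume l: "l \<in> leaves t"
    with assms(2) obtain p where p: "prefix p l" "event_at p \<in> E"
      using processed_blocked[of l] by blast
    moreover from p l have "p \<in> nodes t" using prefix_in_nodes leaf_in_nodes by blast
    ultimately show "\<exists>q. prefix [] q \<and> prefix q l \<and> load t y q = capacity x t q"
      using event_tight[of p] by (intro exI[of _ p]) simp
  qed simp
  ultimately show False by simp
qed

section \<open>The dual greedy algorithm\<close>

lemma dual_value_cong:
  assumes "\<And>s. depth s < d \<Longrightarrow> \<alpha> s = \<alpha>' s" "\<And>s. depth s < d \<Longrightarrow> \<beta> s = \<beta>' s"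
  shows "dual_value \<rho> t E \<gamma> d \<alpha> \<beta> l = dual_value \<rho> t E \<gamma> d \<alpha>' \<beta>' l"
  using assms by (simp add: dual_value_def)

text \<open>
  A value assigned at depth \<open>k\<close> depends only on smaller depths and is not overwritten later, so the
  assignments of the loop hold as equations for its result.
\<close>

lemma dual_greedy_fold:
  assumes "fold (dual_step \<rho> t E f \<gamma>) [1..<Suc d] ((\<lambda>_. 0), (\<lambda>_. 0)) = (\<alpha>, \<beta>)"
  shows "\<alpha> s = (if s \<in> splits t \<and> depth s \<le> d \<and> Event_A s \<in> E
            then dual_value \<rho> t E \<gamma> (depth s) \<alpha> \<beta> (f (Event_A s)) else 0) \<and>
         \<beta> s = (if s \<in> splits t \<and> depth s \<le> d \<and> Event_B s \<in> E
            then dual_value \<rho> t E \<gamma> (depth s) \<alpha> \<beta> (f (Event_B s)) else 0)"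
  using assms
proof (induction d arbitrary: \<alpha> \<beta> s)
  case 0
  then show ?case by (auto simp: depth_def)
next
  case (Suc d)
  obtain a b where ab: "fold (dual_step \<rho> t E f \<gamma>) [1..<Suc d] ((\<lambda>_. 0), (\<lambda>_. 0)) = (a, b)"
    by fastforce
  note IH = Suc.IH[OF ab]
  have step: "dual_step \<rho> t E f \<gamma> (Suc d) (a, b) = (\<alpha>, \<beta>)"
    using Suc.prems ab by simp
  have \<alpha>: "\<alpha> s = (if s \<in> splits t \<and> depth s = Suc d \<and> Event_A s \<in> E
      then dual_value \<rho> t E \<gamma> (Suc d) a b (f (Event_A s)) else a s)" for s
    using step by (auto simp: dual_step_def)
  have \<beta>: "\<beta> s = (if s \<in> splits t \<and> depth s = Suc d \<and> Event_B s \<in> E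
      then dual_value \<rho> t E \<gamma> (Suc d) a b (f (Event_B s)) else b s)" for s
    using step by (auto simp: dual_step_def)
  have dv: "dual_value \<rho> t E \<gamma> k a b l = dual_value \<rho> t E \<gamma> k \<alpha> \<beta> l" if "k \<le> Suc d" for k l
    using that by (intro dual_value_cong) (simp_all add: \<alpha> \<beta>)
  show ?case
    using IH[of s] dv[of "depth s"] dv[of "Suc d"] by (auto simp: \<alpha>[of s] \<beta>[of s])
qed

lemma depth_le_max_depth: "s \<in> splits t \<Longrightarrow> depth s \<le> max_depth t"
  by (auto simp: max_depth_def)

lemma dual_greedy_values:
  assumes "dual_greedy \<rho> t E f = (\<alpha>, \<beta>, \<gamma>)"
  shows "\<gamma> = revenue \<rho> t (f Event_C)"
    and "\<alpha> s = (if s \<in> splits t \<and> Event_A s \<in> E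
            then dual_value \<rho> t E \<gamma> (depth s) \<alpha> \<beta> (f (Event_A s)) else 0)"
    and "\<beta> s = (if s \<in> splits t \<and> Event_B s \<in> E
            then dual_value \<rho> t E \<gamma> (depth s) \<alpha> \<beta> (f (Event_B s)) else 0)"
proof -
  show g: "\<gamma> = revenue \<rho> t (f Event_C)"
    using assms by (auto simp: dual_greedy_def Let_def split: prod.splits)
  have "fold (dual_step \<rho> t E f \<gamma>) [1..<Suc (max_depth t)] ((\<lambda>_. 0), (\<lambda>_. 0)) = (\<alpha>, \<beta>)"
    using assms by (auto simp: dual_greedy_def Let_def split: prod.splits simp del: upt_Suc)
  from dual_greedy_fold[OF this, of s] depth_le_max_depth[of s t]
  show "\<alpha> s = (if s \<in> splits t \<and> Event_A s \<in> E
            then dual_value \<rho> t E \<gamma> (depth s) \<alpha> \<beta> (f (Event_A s)) else 0)"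
    and "\<beta> s = (if s \<in> splits t \<and> Event_B s \<in> E
            then dual_value \<rho> t E \<gamma> (depth s) \<alpha> \<beta> (f (Event_B s)) else 0)"
    by auto
qed

lemma dual_greedy_zero:
  assumes "dual_greedy \<rho> t E f = (\<alpha>, \<beta>, \<gamma>)"
  shows "Event_A s \<notin> E \<Longrightarrow> \<alpha> s = 0" and "Event_B s \<notin> E \<Longrightarrow> \<beta> s = 0"
  by (simp_all add: dual_greedy_values(2,3)[OF assms, of s])

text \<open>
  The sums in \<open>dual_value\<close> run over splits on the path to the leaf \<open>l\<close> that are shallower than \<open>s\<close>. The
  path edges leaving them are exactly the nonempty prefixes of \<open>s\<close>, and restricting to events drops
  only zero prices. The price \<open>\<gamma>\<close> accounts for the empty prefix.
\<close>

lemma dual_value_eq_path_sum: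
  assumes zero: "\<And>s. Event_A s \<notin> E \<Longrightarrow> \<alpha> s = 0" "\<And>s. Event_B s \<notin> E \<Longrightarrow> \<beta> s = 0"
    and l: "l \<in> leaves t" "prefix (s @ [d]) l"
  shows "dual_value \<rho> t E \<gamma> (depth s) \<alpha> \<beta> l =
    revenue \<rho> t l - (\<Sum>p\<in>set (prefixes s). edge_case \<gamma> \<alpha> \<beta> p)"
proof -
  let ?L = "{s' \<in> LS t l. depth s' < depth s}" and ?R = "{s' \<in> RS t l. depth s' < depth s}"
  have "prefix p s \<longleftrightarrow> prefix p l \<and> length p < depth s" for p
  proof
    assume "prefix p s"
    moreover have "prefix s l" using l append_prefixD by blast
    ultimately show "prefix p l \<and> length p < depth s"
      using prefix_order.trans[of p s l] prefix_length_le[of p s] by (simp add: depth_def)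
  next
    assume "prefix p l \<and> length p < depth s"
    moreover have "prefix s l" using l append_prefixD by blast
    ultimately show "prefix p s" by (simp add: depth_def prefix_length_prefix[of p l s])
  qed
  then have "set (prefixes s) = {p \<in> set (prefixes l). length p < depth s}"
    by (simp add: set_eq_iff)
  also have "\<dots> = insert [] ((\<lambda>s. s @ [Left]) ` ?L \<union> (\<lambda>s. s @ [Right]) ` ?R)"
    unfolding prefixes_eq[OF l(1)] by (auto simp: depth_def)
  finally have "(\<Sum>p\<in>set (prefixes s). edge_case \<gamma> \<alpha> \<beta> p) = (\<Sum>s\<in>?L. \<alpha> s) + (\<Sum>s\<in>?R. \<beta> s) + \<gamma>"
    by (simp add: sum_edges)
  moreover have "(\<Sum>s'\<in>{s' \<in> LS t l. Event_A s' \<in> E \<and> depth s' < depth s}. \<alpha> s') = (\<Sum>s\<in>?L. \<alpha> s)"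
    using zero by (intro sum.mono_neutral_left) auto
  moreover have "(\<Sum>s'\<in>{s' \<in> RS t l. Event_B s' \<in> E \<and> depth s' < depth s}. \<beta> s') = (\<Sum>s\<in>?R. \<beta> s)"
    using zero by (intro sum.mono_neutral_left) auto
  ultimately show ?thesis by (simp add: dual_value_def)
qed

lemma sum_prefixes_snoc:
  "(\<Sum>p\<in>set (prefixes (s @ [d])). w p) = (\<Sum>p\<in>set (prefixes s). w p) + (w (s @ [d]) :: real)"
proof -
  have "set (prefixes (s @ [d])) = insert (s @ [d]) (set (prefixes s))" by auto
  moreover have "s @ [d] \<notin> set (prefixes s)" using prefix_length_le[of "s @ [d]" s] by auto
  ultimately show ?thesis by (simp only: sum.insert finite_set not_False_eq_True add.commute)
qed

text \<open>
  The price of a marked node is what is missing from the prices above it to the revenue of its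
  cause.
\<close>

lemma (in greedy_invariant) dual_greedy_path_sum:
  assumes dual: "dual_greedy \<rho> t E f = (\<alpha>, \<beta>, \<gamma>)" and P: "P \<subseteq> leaves t"
    and p: "p \<in> nodes t" "event_at p \<in> E"
  shows "(\<Sum>q\<in>set (prefixes p). edge_case \<gamma> \<alpha> \<beta> q) = revenue \<rho> t (f (event_at p))"
proof -
  note dual_values = dual_greedy_values[OF dual]
  have c: "f (event_at p) \<in> leaves t" "prefix p (f (event_at p))"
    using cause_processed cause_below P p by blast+
  have path: "dual_value \<rho> t E \<gamma> (depth s) \<alpha> \<beta> (f (event_at p)) =
      revenue \<rho> t (f (event_at p)) - (\<Sum>q\<in>set (prefixes s). edge_case \<gamma> \<alpha> \<beta> q)"
    if "p = s @ [d]" for s d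
    by (rule dual_value_eq_path_sum[OF dual_greedy_zero[OF dual] c(1)]) (use c(2) that in simp_all)
  show ?thesis
  proof (cases p rule: node_snoc_cases)
    case Root
    then show ?thesis using dual_values(1) by simp
  next
    case (Left s)
    with p have "s \<in> splits t" "Event_A s \<in> E" by simp_all
    with dual_values(2)[of s] path[OF Left] Left
    have "\<alpha> s = revenue \<rho> t (f (event_at p)) - (\<Sum>q\<in>set (prefixes s). edge_case \<gamma> \<alpha> \<beta> q)"
      by simp
    with Left show ?thesis by (simp only: sum_prefixes_snoc edge_case_simps)
  next
    case (Right s)
    with p have "s \<in> splits t" "Event_B s \<in> E" by simp_all
    with dual_values(3)[of s] path[OF Right] Right
    have "\<beta> s = revenue \<rho> t (f (event_at p)) - (\<Sum>q\<in>set (prefixes s). edge_case \<gamma> \<alpha> \<beta> q)"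
      by simp
    with Right show ?thesis by (simp only: sum_prefixes_snoc edge_case_simps)
  qed
qed

text \<open>
  Unmarked nodes have price \<open>0\<close>, so the path sum does not change below the deepest marked node
  on the path. Such a node exists because the root is marked.
\<close>

lemma (in greedy_invariant) path_sum_deepest_event:
  fixes w :: "node \<Rightarrow> real"
  assumes root: "Event_C \<in> E"
    and sum: "\<And>p. p \<in> nodes t \<Longrightarrow> event_at p \<in> E \<Longrightarrow>
        (\<Sum>q\<in>set (prefixes p). w q) = r (f (event_at p))"
    and zero: "\<And>p. event_at p \<notin> E \<Longrightarrow> w p = 0"
    and "p \<in> nodes t"
  shows "\<exists>q. prefix q p \<and> event_at q \<in> E \<and> (\<Sum>q\<in>set (prefixes p). w q) = r (f (event_at q)) \<and>
    (\<forall>q'. prefix q' p \<and> event_at q' \<in> E \<longrightarrow> prefix q' q)"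
  using assms(4)
proof (induction p rule: rev_induct)
  case Nil
  then show ?case using sum[of "[]"] root by (intro exI[of _ "[]"]) simp
next
  case (snoc d s)
  then have s: "s \<in> nodes t" by (simp add: split_in_nodes)
  show ?case
  proof (cases "event_at (s @ [d]) \<in> E")
    case True
    with sum[OF snoc.prems] show ?thesis by (intro exI[of _ "s @ [d]"]) simp
  next
    case False
    from snoc.IH[OF s] obtain q where q: "prefix q s" "event_at q \<in> E"
      "(\<Sum>q\<in>set (prefixes s). w q) = r (f (event_at q))"
      "\<forall>q'. prefix q' s \<and> event_at q' \<in> E \<longrightarrow> prefix q' q" by blast
    with False zero[OF False] show ?thesis
      by (intro exI[of _ q]) (auto simp: sum_prefixes_snoc)
  qed
qed

section \<open>Optimality\<close>

lemma (in greedy_invariant) complete_greedy_optimal: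
  assumes r: "r = revenue \<rho> t" and P: "P = leaves t" and root: "Event_C \<in> E"
    and dual: "dual_greedy \<rho> t E f = (\<alpha>, \<beta>, \<gamma>)"
  shows "primal_optimal \<rho> t x y" and "dual_optimal \<rho> t x \<alpha> \<beta> \<gamma>"
proof -
  define w where "w = edge_case \<gamma> \<alpha> \<beta>"
  define W where "W p = (\<Sum>q\<in>set (prefixes p). w q)" for p
  have W_event: "W p = r (f (event_at p))" if "p \<in> nodes t" "event_at p \<in> E" for p
    using dual_greedy_path_sum[OF dual _ that] P by (simp add: W_def w_def r)
  have zero: "w p = 0" if "event_at p \<notin> E" for p
    using that root dual_greedy_zero[OF dual]
    by (cases p rule: node_snoc_cases) (simp_all add: w_def)
  have deepest: "\<exists>q. prefix q p \<and> event_at q \<in> E \<and> W p = r (f (event_at q)) \<and>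
    (\<forall>q'. prefix q' p \<and> event_at q' \<in> E \<longrightarrow> prefix q' q)" if "p \<in> nodes t" for p
    using path_sum_deepest_event[of w, OF root W_event[unfolded W_def] zero that]
    unfolding W_def by blast
  have primal: "primal_feasible t x y"
    using event_tight[of "[]"] root load_le sol_nonneg
    by (simp add: primal_feasible_iff_load)
  (* The mark that blocked l lies above the deepest mark on the path, whose cause is at least as
     valuable. *)
  have W_ge: "r l \<le> W l" if l: "l \<in> leaves t" for l
  proof -
    obtain p where p: "prefix p l" "event_at p \<in> E" "r l \<le> r (f (event_at p))"
      using processed_blocked l P by blast
    obtain q where q: "prefix q l" "event_at q \<in> E" "W l = r (f (event_at q))" "prefix p q"
      using deepest[OF leaf_in_nodes[OF l]] p by blast
    have "q \<in> nodes t" using prefix_in_nodes[OF leaf_in_nodes[OF l]] q by blast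
    with cause_mono[of q p] p q show ?thesis
      by (metis order_trans order_refl prefix_order.le_less)
  qed
  (* The price of a marked node is the difference between the revenue of its own cause and that of
     the cause of the next mark above it. *)
  have nonneg: "0 \<le> w p" if p: "p \<in> nodes t - {[]}" for p
  proof (cases "event_at p \<in> E")
    case True
    from p obtain s d where pd: "p = s @ [d]" by (cases p rule: rev_cases) auto
    with p have "s \<in> nodes t" by (simp add: split_in_nodes)
    from deepest[OF this] obtain q
      where q: "prefix q s" "event_at q \<in> E" "W s = r (f (event_at q))" by blast
    have "strict_prefix q p"
      using q(1) prefix_length_le[OF q(1)] by (auto simp: pd strict_prefix_def)
    with cause_mono[of p q] p q True W_event have "W s \<le> W p" by simp
    then show ?thesis by (simp add: W_def pd sum_prefixes_snoc)
  qed (simp add: zero)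
  have dualf: "dual_feasible \<rho> t \<alpha> \<beta> \<gamma>"
    unfolding dual_feasible_iff_price using W_ge nonneg by (simp add: W_def w_def r)
  have leaf: "W l = r l" if l: "l \<in> leaves t" "0 < y l" for l
  proof -
    obtain q where "prefix q l" "event_at q \<in> E" "W l = r (f (event_at q))"
      using deepest[OF leaf_in_nodes[OF l(1)]] by blast
    with cause_le_positive[OF l] W_ge[OF l(1)] show ?thesis by force
  qed
  have edge: "load t y p = capacity x t p" if "p \<in> nodes t" "w p \<noteq> 0" for p
    using that event_tight zero by blast
  show "primal_optimal \<rho> t x y" "dual_optimal \<rho> t x \<alpha> \<beta> \<gamma>"
    using complementary_slackness_optimal[OF primal dualf] leaf edge
    by (simp_all add: W_def w_def r)
qed

theorem theorem4:
  fixes n :: nat and \<rho> x :: "nat \<Rightarrow> real" and t :: pdtree and \<tau> :: "nat \<Rightarrow> node"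
    and y \<alpha> \<beta> :: "node \<Rightarrow> real" and \<gamma> :: real
    and E :: "event set" and f :: "event \<Rightarrow> node"
  assumes "purchase_tree n t"
    and "\<rho> 0 = 0"
    and "\<forall>i\<in>{1..n}. 0 \<le> x i \<and> x i \<le> 1"
    and "revenue_order \<rho> t \<tau>"
    and "primal_greedy x t \<tau> = (y, E, f)"
    and "dual_greedy \<rho> t E f = (\<alpha>, \<beta>, \<gamma>)"
  shows "primal_optimal \<rho> t x y \<and> dual_optimal \<rho> t x \<alpha> \<beta> \<gamma>"
proof -
  have x: "\<forall>s\<in>splits t. 0 \<le> x (split_label t s) \<and> x (split_label t s) \<le> 1"
    using assms(1,3) by (simp add: purchase_tree_def)
  have "\<tau> ` {1..<Suc (card (leaves t))} = leaves t"
    using assms(4) by (simp add: revenue_order_def bij_betw_def atLeastLessThanSuc_atLeastAtMost)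
  then interpret greedy_invariant t x "revenue \<rho> t" "leaves t" y E f
    using primal_greedy_invariant[OF x assms(4) order_refl] assms(5)
    by (auto simp: primal_greedy_def Let_def simp del: upt_Suc)
  show ?thesis
    using complete_greedy_optimal[OF refl refl greedy_complete[OF x refl] assms(6)] by blast
qed

end
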